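(* Assume $\mathcal Q_\Lambda^{\mathrm{cl}}\neq\{0\}$ and the following two conditions. (Gauge compatibility) For all $d\in\mathcal K_\Lambda^{\mathrm{cl}}$, $\gamma\in\Gamma_\Lambda^{\mathrm{cl}}$: $O_\Lambda^{\mathrm{cl}}(d+\gamma)=O_\Lambda^{\mathrm{cl}}d$, $\operatorname{Rep}_\Lambda^{\mathrm{cl}}(d+\gamma)=\operatorname{Rep}_\Lambda^{\mathrm{cl}}(d)$, $\operatorname{Tax}_\Lambda^{\mathrm{cl}}(d+\gamma)=\operatorname{Tax}_\Lambda^{\mathrm{cl}}(d)$. (Kernel-free) For every $d\in\mathcal K_\Lambda^{\mathrm{cl}}$, if $O_\Lambda^{\mathrm{cl}}d=0$, $\operatorname{Rep}_\Lambda^{\mathrm{cl}}(d)=0$ and $\operatorname{Tax}_\Lambda^{\mathrm{cl}}(d)=0$, then $d\in\Gamma_\Lambda^{\mathrm{cl}}$. Then $\mu_\Lambda^{\mathrm{comp}}>0$, and every $d\in\mathcal K_\Lambda^{\mathrm{cl}}$ satisfies $$\|O_\Lambda^{\mathrm{cl}}d\|+C_R\operatorname{Rep}_\Lambda^{\mathrm{cl}}(d)+C_T\operatorname{Tax}_\Lambda^{\mathrm{cl}}(d)\ \ge\ \mu_\Lambda^{\mathrm{comp}}\operatorname{dist}_{\mathrm{cl}}(d,\Gamma_\Lambda^{\mathrm{cl}}).$$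
   Context: Let $\Lambda=\{k_0,k_0+1,\dots,k_0+L\}$ be a finite set of consecutive integers and $\Lambda_{\mathrm{adj}}=\{k\in\Lambda: k+1\in\Lambda\}$. For $k\in\Lambda$ let $\mathcal D_k^{\mathrm{cl}}$ be a finite-dimensional real normed space with norm $\|\cdot\|_{\mathrm{cl},k}$; let $\mathcal D_\Lambda^{\mathrm{cl}}=\prod_{k\in\Lambda}\mathcal D_k^{\mathrm{cl}}$ carry a fixed norm $\|\cdot\|_{\mathrm{cl}}$, and let $\mathcal K_\Lambda^{\mathrm{cl}}\subset\mathcal D_\Lambda^{\mathrm{cl}}$ be a linear subspace. Let $G_\Lambda^{\mathrm{cl}}:\mathcal C_\Lambda^{\mathrm{cl}}\to\mathcal D_\Lambda^{\mathrm{cl}}$ be a linear map from a finite-dimensional real normed space, and $\Gamma_\Lambda^{\mathrm{cl}}=\mathcal K_\Lambda^{\mathrm{cl}}\cap\operatorname{Im}G_\Lambda^{\mathrm{cl}}$. For $d\in\mathcal K_\Lambda^{\mathrm{cl}}$ put $\operatorname{dist}_{\mathrm{cl}}(d,\Gamma_\Lambda^{\mathrm{cl}})=\inf_{\gamma\in\Gamma_\Lambda^{\mathrm{cl}}}\|d-\gamma\|_{\mathrm{cl}}$; this is the quotient norm of $[d]$ in $\mathcal Q_\Lambda^{\mathrm{cl}}=\mathcal K_\Lambda^{\mathrm{cl}}/\Gamma_\Lambda^{\mathrm{cl}}$, and $S_\Lambda^{\mathrm{cl}}$ denotes the unit sphere of $\mathcal Q_\Lambda^{\mathrm{cl}}$.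 Observation: $O_\Lambda^{\mathrm{cl}}=(O_\Lambda^P,O_\Lambda^F,O_\Lambda^E,O_\Lambda^T):\mathcal K_\Lambda^{\mathrm{cl}}\to\mathcal Y_\Lambda^P\times\mathcal Y_\Lambda^F\times\mathcal Y_\Lambda^E\times\mathcal Y_\Lambda^T$ is linear, into a product (with a fixed norm) of finite-dimensional normed spaces. Reproduction: for fixed linear maps $R_k^{\mathrm{cl}}:\mathcal D_k^{\mathrm{cl}}\to\mathcal D_{k+1}^{\mathrm{cl}}$ ($k\in\Lambda_{\mathrm{adj}}$), $\operatorname{Rep}_\Lambda^{\mathrm{cl}}(d)=\big(\sum_{k\in\Lambda_{\mathrm{adj}}}\|d_{k+1}-R_k^{\mathrm{cl}}d_k\|_{\mathrm{cl},k+1}^2\big)^{1/2}$. Tax: $\operatorname{Tax}_\Lambda^{\mathrm{cl}}:\mathcal K_\Lambda^{\mathrm{cl}}\to[0,\infty)$ is continuous with $\operatorname{Tax}_\Lambda^{\mathrm{cl}}(\lambda d)=|\lambda|\operatorname{Tax}_\Lambda^{\mathrm{cl}}(d)$ for $\lambda\in\mathbb R$. For fixed $C_R,C_T>0$ put $\mathcal M_\Lambda^{\mathrm{comp}}(d)=\|O_\Lambda^{\mathrm{cl}}d\|+C_R\operatorname{Rep}_\Lambda^{\mathrm{cl}}(d)+C_T\operatorname{Tax}_\Lambda^{\mathrm{cl}}(d)$. Under gauge compatibility $\mathcal M_\Lambda^{\mathrm{comp}}$ descends to $\overline{\mathcal M}_\Lambda^{\mathrm{comp}}([d])=\mathcal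 M_\Lambda^{\mathrm{comp}}(d)$ on $\mathcal Q_\Lambda^{\mathrm{cl}}$, and $\mu_\Lambda^{\mathrm{comp}}:=\inf_{q\in S_\Lambda^{\mathrm{cl}}}\overline{\mathcal M}_\Lambda^{\mathrm{comp}}(q)$. *)

theory Defs
  imports "HOL-Analysis.Analysis" "HOL-Library.Function_Algebras"
begin

text \<open>The pointwise additive structure on functions comes from \<^theory>\<open>HOL-Library.Function_Algebras\<close>;
  we add pointwise scalar multiplication, so that \<^term>\<open>subspace\<close> and \<^term>\<open>linear\<close> apply to
  families of vectors.\<close>

instantiation "fun" :: (type, real_vector) real_vector
begin

definition scaleR_fun :: "real \<Rightarrow> ('a \<Rightarrow> 'b) \<Rightarrow> 'a \<Rightarrow> 'b"
  where "scaleR_fun c f = (\<lambda>x. c *\<^sub>R f x)"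

instance
  by standard (auto simp: scaleR_fun_def fun_eq_iff scaleR_add_right scaleR_add_left)

end

definition fin_dim :: "'a::real_vector set \<Rightarrow> bool"
  where "fin_dim V \<longleftrightarrow> (\<exists>B. finite B \<and> V = span B)"

text \<open>A norm on a subspace \<open>V\<close>; the values of \<open>N\<close> outside \<open>V\<close> are irrelevant.\<close>

definition norm_on :: "'a::real_vector set \<Rightarrow> ('a \<Rightarrow> real) \<Rightarrow> bool"
  where "norm_on V N \<longleftrightarrow>
    (\<forall>x\<in>V. 0 \<le> N x) \<and>
    (\<forall>x\<in>V. N x = 0 \<longleftrightarrow> x = 0) \<and>
    (\<forall>x\<in>V. \<forall>c. N (c *\<^sub>R x) = \<bar>c\<bar> * N x) \<and>
    (\<forall>x\<in>V. \<forall>y\<in>V. N (x + y) \<le> N x + N y)"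

text \<open>\<^locale>\<open>Metric_space\<close> asks for symmetry and nonnegativity of the distance on the whole type, so
  the distance \<open>N (x - y)\<close> is replaced by \<open>0\<close> outside \<open>V\<close>; the topology only involves points
  of \<open>V\<close>.\<close>

definition norm_dist :: "'a::real_vector set \<Rightarrow> ('a \<Rightarrow> real) \<Rightarrow> 'a \<Rightarrow> 'a \<Rightarrow> real"
  where "norm_dist V N x y = (if x \<in> V \<and> y \<in> V then N (x - y) else 0)"

definition norm_topology :: "'a::real_vector set \<Rightarrow> ('a \<Rightarrow> real) \<Rightarrow> 'a topology"
  where "norm_topology V N = Metric_space.mtopology V (norm_dist V N)"

lemma Metric_space_norm_dist:
  assumes "subspace V" "norm_on V N"
  shows "Metric_space V (norm_dist V N)"
proof -
  have sub: "x - y \<in> V" if "x \<in> V" "y \<in> V" for x y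
    using assms(1) that by (rule subspace_diff)
  have nonneg: "0 \<le> N x" and zero: "N x = 0 \<longleftrightarrow> x = 0"
    and scale: "N (c *\<^sub>R x) = \<bar>c\<bar> * N x" if "x \<in> V" for x c
    using assms(2) that by (simp_all add: norm_on_def)
  have tri: "N (x + y) \<le> N x + N y" if "x \<in> V" "y \<in> V" for x y
    using assms(2) that by (simp add: norm_on_def)
  show ?thesis
  proof
    fix x y
    show "0 \<le> norm_dist V N x y" using nonneg sub by (simp add: norm_dist_def)
    show "norm_dist V N x y = norm_dist V N y x"
    proof (cases "x \<in> V \<and> y \<in> V")
      case True
      then have "N ((- 1) *\<^sub>R (y - x)) = \<bar>- 1\<bar> * N (y - x)"
        using scale sub by blast
      then show ?thesis using True by (simp add: norm_dist_def)
    qed (auto simp: norm_dist_def)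
  next
    fix x y assume "x \<in> V" "y \<in> V"
    then show "norm_dist V N x y = 0 \<longleftrightarrow> x = y"
      using zero[OF sub] by (simp add: norm_dist_def)
  next
    fix x y z assume xyz: "x \<in> V" "y \<in> V" "z \<in> V"
    then have "N ((x - y) + (y - z)) \<le> N (x - y) + N (y - z)"
      using tri sub by blast
    then show "norm_dist V N x z \<le> norm_dist V N x y + norm_dist V N y z"
      using xyz by (simp add: norm_dist_def)
  qed
qed

definition linear_map_on :: "'a::real_vector set \<Rightarrow> 'b::real_vector set \<Rightarrow> ('a \<Rightarrow> 'b) \<Rightarrow> bool"
  where "linear_map_on V W f \<longleftrightarrow>
    f ` V \<subseteq> W \<and>
    (\<forall>x\<in>V. \<forall>y\<in>V. f (x + y) = f x + f y) \<and>
    (\<forall>x\<in>V. \<forall>c. f (c *\<^sub>R x) = c *\<^sub>R f x)"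

text \<open>The spaces \<open>D k\<close>, whose dimensions may vary with \<open>k\<close>, are finite-dimensional subspaces of one
  arbitrary ambient vector space.  Their product over \<open>\<Lambda>\<close> consists of the families that are extended
  by \<open>0\<close> outside \<open>\<Lambda>\<close>; this is a subspace of the function space.\<close>

definition prod_space :: "int set \<Rightarrow> (int \<Rightarrow> 'a::real_vector set) \<Rightarrow> (int \<Rightarrow> 'a) set"
  where "prod_space \<Lambda> D = {d. (\<forall>k\<in>\<Lambda>. d k \<in> D k) \<and> (\<forall>k. k \<notin> \<Lambda> \<longrightarrow> d k = 0)}"

definition adj :: "int set \<Rightarrow> int set"
  where "adj \<Lambda> = {k \<in> \<Lambda>. k + 1 \<in> \<Lambda>}"

definition Rep :: "int set \<Rightarrow> (int \<Rightarrow> 'a::real_vector \<Rightarrow> real) \<Rightarrow> (int \<Rightarrow> 'a \<Rightarrow> 'a) \<Rightarrow> (int \<Rightarrow> 'a) \<Rightarrow> real"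
  where "Rep \<Lambda> n R d = sqrt (\<Sum>k\<in>adj \<Lambda>. (n (k + 1) (d (k + 1) - R k (d k)))\<^sup>2)"

definition comp_measure ::
  "('y \<Rightarrow> real) \<Rightarrow> ('d \<Rightarrow> 'y) \<Rightarrow> ('d \<Rightarrow> real) \<Rightarrow> ('d \<Rightarrow> real) \<Rightarrow> real \<Rightarrow> real \<Rightarrow> 'd \<Rightarrow> real"
  where "comp_measure NY Ob rep tax C\<^sub>R C\<^sub>T d = NY (Ob d) + C\<^sub>R * rep d + C\<^sub>T * tax d"

definition dist_to :: "('a::real_vector \<Rightarrow> real) \<Rightarrow> 'a \<Rightarrow> 'a set \<Rightarrow> real"
  where "dist_to N d \<Gamma> = (INF \<gamma>\<in>\<Gamma>. N (d - \<gamma>))"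

definition quot_rel :: "'a::real_vector set \<Rightarrow> 'a set \<Rightarrow> ('a \<times> 'a) set"
  where "quot_rel K \<Gamma> = {(x, y). x \<in> K \<and> y \<in> K \<and> y - x \<in> \<Gamma>}"

definition quot_class :: "'a::real_vector set \<Rightarrow> 'a set \<Rightarrow> 'a \<Rightarrow> 'a set"
  where "quot_class K \<Gamma> d = quot_rel K \<Gamma> `` {d}"

definition quot_space :: "'a::real_vector set \<Rightarrow> 'a set \<Rightarrow> 'a set set"
  where "quot_space K \<Gamma> = K // quot_rel K \<Gamma>"

definition quot_norm :: "('a \<Rightarrow> real) \<Rightarrow> 'a set \<Rightarrow> real"
  where "quot_norm N q = (INF x\<in>q. N x)"

definition quot_sphere :: "('a::real_vector \<Rightarrow> real) \<Rightarrow> 'a set \<Rightarrow> 'a set \<Rightarrow> 'a set set"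
  where "quot_sphere N K \<Gamma> = {q \<in> quot_space K \<Gamma>. quot_norm N q = 1}"

text \<open>The function induced on cosets by \<open>M\<close>; meaningful only if \<open>M\<close> is constant on each coset
  (see \<open>descend_quot_class\<close> below).\<close>

definition descend :: "('a \<Rightarrow> real) \<Rightarrow> 'a set \<Rightarrow> real"
  where "descend M q = the_elem (M ` q)"

definition comp_margin :: "('a::real_vector \<Rightarrow> real) \<Rightarrow> 'a set \<Rightarrow> 'a set \<Rightarrow> ('a \<Rightarrow> real) \<Rightarrow> real"
  where "comp_margin N K \<Gamma> M = (INF q\<in>quot_sphere N K \<Gamma>. descend M q)"

lemma quot_class_eq:
  assumes "subspace K" "subspace \<Gamma>" "\<Gamma> \<subseteq> K" "d \<in> K"
  shows "quot_class K \<Gamma> d = (\<lambda>\<gamma>. d + \<gamma>) ` \<Gamma>"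
proof (intro set_eqI iffI)
  fix x assume "x \<in> quot_class K \<Gamma> d"
  then have "x - d \<in> \<Gamma>" by (auto simp: quot_class_def quot_rel_def)
  moreover have "x = d + (x - d)" by simp
  ultimately show "x \<in> (\<lambda>\<gamma>. d + \<gamma>) ` \<Gamma>" by blast
next
  fix x assume "x \<in> (\<lambda>\<gamma>. d + \<gamma>) ` \<Gamma>"
  then show "x \<in> quot_class K \<Gamma> d"
    using assms by (auto simp: quot_class_def quot_rel_def intro: subspace_add)
qed

lemma equiv_quot_rel:
  assumes "subspace K" "subspace \<Gamma>" "\<Gamma> \<subseteq> K"
  shows "equiv K (quot_rel K \<Gamma>)"
proof (rule equivI)
  show "quot_rel K \<Gamma> \<subseteq> K \<times> K" by (auto simp: quot_rel_def)
  show "refl_on K (quot_rel K \<Gamma>)"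
    using subspace_0[OF assms(2)] by (auto simp: refl_on_def quot_rel_def)
  show "sym (quot_rel K \<Gamma>)"
    unfolding sym_def quot_rel_def using subspace_neg[OF assms(2)] by fastforce
  show "trans (quot_rel K \<Gamma>)"
    unfolding trans_def quot_rel_def using subspace_add[OF assms(2)] by fastforce
qed

lemma quot_norm_quot_class:
  assumes "subspace K" "subspace \<Gamma>" "\<Gamma> \<subseteq> K" "d \<in> K"
  shows "quot_norm N (quot_class K \<Gamma> d) = dist_to N d \<Gamma>"
proof -
  have "(\<lambda>\<gamma>. d + \<gamma>) ` \<Gamma> = (\<lambda>\<gamma>. d - \<gamma>) ` \<Gamma>"
  proof (intro set_eqI iffI)
    fix x assume "x \<in> (\<lambda>\<gamma>. d + \<gamma>) ` \<Gamma>"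
    then obtain g where "g \<in> \<Gamma>" "x = d - (- g)" by auto
    then show "x \<in> (\<lambda>\<gamma>. d - \<gamma>) ` \<Gamma>" using subspace_neg[OF assms(2)] by blast
  next
    fix x assume "x \<in> (\<lambda>\<gamma>. d - \<gamma>) ` \<Gamma>"
    then obtain g where "g \<in> \<Gamma>" "x = d + (- g)" by auto
    then show "x \<in> (\<lambda>\<gamma>. d + \<gamma>) ` \<Gamma>" using subspace_neg[OF assms(2)] by blast
  qed
  then show ?thesis
    by (simp add: quot_norm_def dist_to_def quot_class_eq[OF assms] image_image flip: image_comp)
qed

lemma descend_quot_class:
  assumes "subspace K" "subspace \<Gamma>" "\<Gamma> \<subseteq> K" "d \<in> K"
    and "\<And>\<gamma>. \<gamma> \<in> \<Gamma> \<Longrightarrow> M (d + \<gamma>) = M d"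
  shows "descend M (quot_class K \<Gamma> d) = M d"
proof -
  have "M ` quot_class K \<Gamma> d = {M d}"
    using assms(5) subspace_0[OF assms(2)] by (auto simp: quot_class_eq[OF assms(1-4)] image_iff)
  then show ?thesis by (simp add: descend_def)
qed

end

theory Submission
  imports Defs
begin

text \<open>All spaces are finite-dimensional, but their norms are only given on subspaces of an
  arbitrary vector space, so compactness is used in the form that norm-bounded sequences have
  convergent subsequences.  This is proved by induction on a spanning set: the coefficient of a new
  vector \<open>b\<close> is bounded because \<open>b\<close> has positive distance to the span of the others.
  If the margin were \<open>0\<close>, one could choose cosets at distance \<open>1\<close> from \<open>0\<close> on
  which the composite measurement tends to \<open>0\<close>, with bounded representatives.  A limit point of these has
  vanishing measurement, hence lies in \<open>\<Gamma>\<close>, contradicting the distance \<open>1\<close>.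
  The inequality follows by homogeneity.\<close>

section \<open>Norms and seminorms given on a subspace\<close>

lemma norm_on_subset:
  assumes "norm_on V N" "W \<subseteq> V"
  shows "norm_on W N"
  using assms by (simp add: norm_on_def subset_eq)

text \<open>The observation and reproduction terms are norms of linear images, so they may vanish at
  nonzero vectors. What survives composition with a linear map is exactly this notion, and it is
  enough for continuity in finite dimension.\<close>

definition seminorm_on :: "'a::real_vector set \<Rightarrow> ('a \<Rightarrow> real) \<Rightarrow> bool"
  where "seminorm_on V p \<longleftrightarrow>
    (\<forall>x\<in>V. 0 \<le> p x) \<and>
    (\<forall>x\<in>V. \<forall>c. p (c *\<^sub>R x) = \<bar>c\<bar> * p x) \<and>
    (\<forall>x\<in>V. \<forall>y\<in>V. p (x + y) \<le> p x + p y)"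

lemma norm_on_imp_seminorm_on: "norm_on V N \<Longrightarrow> seminorm_on V N"
  by (simp add: norm_on_def seminorm_on_def)

lemma seminorm_onD:
  assumes "seminorm_on V p" "x \<in> V"
  shows seminorm_on_nonneg: "0 \<le> p x"
    and seminorm_on_scale: "p (c *\<^sub>R x) = \<bar>c\<bar> * p x"
    and seminorm_on_triangle: "y \<in> V \<Longrightarrow> p (x + y) \<le> p x + p y"
  using assms by (simp_all add: seminorm_on_def)

lemmas norm_on_nonneg = seminorm_on_nonneg[OF norm_on_imp_seminorm_on]
  and norm_on_scale = seminorm_on_scale[OF norm_on_imp_seminorm_on]
  and norm_on_triangle = seminorm_on_triangle[OF norm_on_imp_seminorm_on]

lemma norm_on_diff_commute:
  assumes "subspace V" "norm_on V N" "x \<in> V" "y \<in> V"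
  shows "N (x - y) = N (y - x)"
proof -
  have "N ((- 1) *\<^sub>R (y - x)) = \<bar>- 1\<bar> * N (y - x)"
    using assms(2) subspace_diff[OF assms(1,4,3)] by (rule norm_on_scale)
  then show ?thesis by simp
qed

lemma seminorm_on_diff_le:
  assumes "subspace V" "seminorm_on V p" "x \<in> V" "y \<in> V"
  shows "\<bar>p x - p y\<bar> \<le> p (x - y)"
proof -
  have d: "x - y \<in> V" "y - x \<in> V" using assms subspace_diff by blast+
  have "p ((- 1) *\<^sub>R (y - x)) = \<bar>- 1\<bar> * p (y - x)"
    using assms(2) d(2) by (rule seminorm_on_scale)
  then have "p (x - y) = p (y - x)" by simp
  moreover have "p (y + (x - y)) \<le> p y + p (x - y)" "p (x + (y - x)) \<le> p x + p (y - x)"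
    using assms(2-4) d by (simp_all only: seminorm_on_triangle)
  ultimately show ?thesis by simp
qed

lemma seminorm_on_compose:
  assumes "seminorm_on W p" "linear_map_on V W f"
  shows "seminorm_on V (\<lambda>x. p (f x))"
proof -
  have "f x \<in> W" if "x \<in> V" for x
    using that assms(2) by (auto simp: linear_map_on_def)
  then show ?thesis
    using assms by (simp add: seminorm_on_def linear_map_on_def)
qed

section \<open>Sequential compactness in finite dimension\<close>

text \<open>The limit is required to lie in \<open>W\<close> itself, so the property also yields
  that \<open>W\<close> is closed in a larger normed space; \<open>norm_on_gap\<close> exploits
  this.\<close>

definition bounded_subseq_convergent :: "'a::real_vector set \<Rightarrow> ('a \<Rightarrow> real) \<Rightarrow> bool"
  where "bounded_subseq_convergent W N \<longleftrightarrow>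
    (\<forall>x C. (\<forall>i::nat. x i \<in> W \<and> N (x i) \<le> C) \<longrightarrow>
      (\<exists>r l. strict_mono r \<and> l \<in> W \<and> (\<lambda>i. N (x (r i) - l)) \<longlonglongrightarrow> 0))"

lemma bounded_subseq_convergentE:
  assumes "bounded_subseq_convergent W N" "\<And>i::nat. x i \<in> W" "\<And>i. N (x i) \<le> C"
  obtains r l where "strict_mono r" "l \<in> W" "(\<lambda>i. N (x (r i) - l)) \<longlonglongrightarrow> 0"
  using assms unfolding bounded_subseq_convergent_def by blast

text \<open>Points \<open>w i\<close> of \<open>W\<close> approaching \<open>v\<close> are bounded,
  so a subsequence converges to some \<open>l\<close> in \<open>W\<close>. Then
  \<open>N (v - l) = 0\<close> by the triangle inequality, and \<open>v = l\<close> would lie in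
  \<open>W\<close>.\<close>

lemma norm_on_gap:
  assumes V: "subspace V" and N: "norm_on V N" and W: "W \<subseteq> V"
    and bsc: "bounded_subseq_convergent W N" and v: "v \<in> V" "v \<notin> W"
  obtains e where "e > 0" "\<And>w. w \<in> W \<Longrightarrow> e \<le> N (v - w)"
proof -
  have "\<exists>e>0. \<forall>w\<in>W. e \<le> N (v - w)"
  proof (rule ccontr)
    assume "\<not> ?thesis"
    then have "\<exists>w\<in>W. N (v - w) < inverse (real (Suc i))" for i
      by (meson inverse_positive_iff_positive not_le of_nat_0_less_iff zero_less_Suc)
    then obtain w where w: "\<And>i. w i \<in> W" "\<And>i. N (v - w i) < inverse (real (Suc i))"
      by metis
    have wV: "w i \<in> V" for i using w W by blast
    \<comment> \<open>The approximants stay within distance 1 of \<open>v\<close>, since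
      \<open>inverse (real (Suc i))\<close> is at most 1.\<close>
    have "N (w i) \<le> N v + 1" for i
    proof -
      have "\<bar>N (w i) - N v\<bar> \<le> N (w i - v)"
        using seminorm_on_diff_le[OF V norm_on_imp_seminorm_on[OF N]] wV v by blast
      moreover have "N (w i - v) = N (v - w i)"
        using norm_on_diff_commute[OF V N] wV v by blast
      moreover have "inverse (real (Suc i)) \<le> 1" by (simp add: field_simps)
      ultimately show ?thesis using w(2)[of i] by linarith
    qed
    then obtain r l where r: "strict_mono r" "l \<in> W" and lim: "(\<lambda>i. N (w (r i) - l)) \<longlonglongrightarrow> 0"
      by (rule bounded_subseq_convergentE[OF bsc w(1)])
    have lV: "l \<in> V" using r W by blast
    have "(\<lambda>i. inverse (real (Suc (r i)))) \<longlonglongrightarrow> 0"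
      using LIMSEQ_subseq_LIMSEQ[OF LIMSEQ_inverse_real_of_nat r(1)] by (simp add: o_def)
    then have "(\<lambda>i. inverse (real (Suc (r i))) + N (w (r i) - l)) \<longlonglongrightarrow> 0"
      using tendsto_add[OF _ lim] by fastforce
    moreover have "N (v - l) \<le> inverse (real (Suc (r i))) + N (w (r i) - l)" for i
    proof -
      have "N ((v - w (r i)) + (w (r i) - l)) \<le> N (v - w (r i)) + N (w (r i) - l)"
        using subspace_diff[OF V v(1) wV] subspace_diff[OF V wV lV] by (rule norm_on_triangle[OF N])
      then show ?thesis using w(2)[of "r i"] by simp
    qed
    ultimately have "N (v - l) \<le> 0" by (intro LIMSEQ_le_const) auto
    then have "v - l = 0"
      using N subspace_diff[OF V v(1) lV] unfolding norm_on_def by (meson order_antisym)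
    then show False using r v by simp
  qed
  then show ?thesis using that by blast
qed

text \<open>For nonzero \<open>c\<close>, the vector \<open>c *\<^sub>R b + y\<close> is
  \<open>c\<close> times a difference of \<open>b\<close> and an element of \<open>span B\<close>,
  so the gap \<open>e\<close> between \<open>b\<close> and \<open>span B\<close> is magnified by the
  absolute value of \<open>c\<close>. Thus the coordinate along \<open>b\<close> is controlled by
  the norm.\<close>

lemma norm_on_coordinate_bound:
  assumes N: "norm_on (span (insert b B)) N" and b: "b \<notin> span B"
    and bsc: "bounded_subseq_convergent (span B) N"
  obtains e where "e > 0" "\<And>c y. y \<in> span B \<Longrightarrow> \<bar>c\<bar> * e \<le> N (c *\<^sub>R b + y)"
proof -
  have sub: "span B \<subseteq> span (insert b B)" by (simp add: span_mono subset_insertI)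
  have bV: "b \<in> span (insert b B)" by (simp add: span_base)
  obtain e where e: "e > 0" "\<And>w. w \<in> span B \<Longrightarrow> e \<le> N (b - w)"
    using norm_on_gap[OF subspace_span N sub bsc bV b] by blast
  have "\<bar>c\<bar> * e \<le> N (c *\<^sub>R b + y)" if y: "y \<in> span B" for c y
  proof (cases "c = 0")
    case True
    then show ?thesis using N y sub by (auto simp: norm_on_def)
  next
    case False
    have w: "(- (1 / c)) *\<^sub>R y \<in> span B" using y by (rule span_scale)
    have "N (c *\<^sub>R (b - (- (1 / c)) *\<^sub>R y)) = \<bar>c\<bar> * N (b - (- (1 / c)) *\<^sub>R y)"
      using w sub bV by (intro norm_on_scale[OF N] span_diff) auto
    moreover have "c *\<^sub>R (b - (- (1 / c)) *\<^sub>R y) = c *\<^sub>R b + y"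
      using False by (simp add: scaleR_add_right)
    ultimately show ?thesis using e(2)[OF w] by (simp add: mult_left_mono)
  qed
  then show ?thesis using that e(1) by blast
qed

lemma span_insertE:
  assumes "x \<in> span (insert b B)"
  obtains c y where "y \<in> span B" "x = c *\<^sub>R b + y"
proof -
  obtain c where "x - c *\<^sub>R b \<in> span B" using assms span_breakdown_eq by blast
  then show ?thesis by (intro that[of "x - c *\<^sub>R b" c]) auto
qed

text \<open>In the induction step each \<open>x i\<close> splits as
  \<open>c i *\<^sub>R b + y i\<close>. Boundedness of the \<open>c i\<close> makes the
  \<open>y i\<close> bounded too; the induction hypothesis handles the vectors and
  Bolzano-Weierstrass the real coefficients.\<close>

lemma bounded_subseq_convergent_span:
  assumes "finite B" "norm_on (span B) N"
  shows "bounded_subseq_convergent (span B) N"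
  using assms
proof (induction B)
  case empty
  have "N 0 = 0" using empty by (simp add: norm_on_def)
  then show ?case
    by (auto simp: bounded_subseq_convergent_def intro!: exI[of _ id] strict_mono_id)
next
  case (insert b B)
  let ?V = "span (insert b B)"
  have sub: "span B \<subseteq> ?V" by (simp add: span_mono subset_insertI)
  have bV: "b \<in> ?V" by (simp add: span_base)
  have bsc: "bounded_subseq_convergent (span B) N"
    using insert norm_on_subset[OF _ sub] by blast
  show ?case
  proof (cases "b \<in> span B")
    case True
    then show ?thesis using bsc by (simp add: span_redundant)
  next
    case False
    then obtain e where e: "e > 0" "\<And>c y. y \<in> span B \<Longrightarrow> \<bar>c\<bar> * e \<le> N (c *\<^sub>R b + y)"
      using norm_on_coordinate_bound[OF insert.prems _ bsc] by metis
    show ?thesis unfolding bounded_subseq_convergent_def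
    proof (intro allI impI)
      fix x :: "nat \<Rightarrow> 'a" and C assume x: "\<forall>i. x i \<in> ?V \<and> N (x i) \<le> C"
      have "\<exists>c y. y \<in> span B \<and> x i = c *\<^sub>R b + y" for i
        using x span_insertE by blast
      then obtain c y where y: "\<And>i. y i \<in> span B" and xeq: "\<And>i. x i = c i *\<^sub>R b + y i"
        by metis
      have yV: "y i \<in> ?V" for i using y sub by blast
      have scale: "N (a *\<^sub>R b) = \<bar>a\<bar> * N b" for a
        using insert.prems bV by (simp add: norm_on_def)
      have cb: "\<bar>c i\<bar> \<le> C / e" for i
      proof -
        have "\<bar>c i\<bar> * e \<le> C" using e(2)[OF y, of "c i" i] x xeq by (metis order_trans)
        then show ?thesis using e(1) by (simp add: field_simps)
      qed
      have Nb: "0 \<le> N b" using insert.prems bV by (simp add: norm_on_def)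
      have yb: "N (y i) \<le> C + C / e * N b" for i
      proof -
        have cbV: "(- c i) *\<^sub>R b \<in> ?V" using bV by (rule span_scale)
        have "N (x i + (- c i) *\<^sub>R b) \<le> N (x i) + N ((- c i) *\<^sub>R b)"
          using x cbV by (intro norm_on_triangle[OF insert.prems]) auto
        moreover have "x i + (- c i) *\<^sub>R b = y i" by (simp add: xeq)
        moreover have "N ((- c i) *\<^sub>R b) \<le> C / e * N b"
          unfolding scale abs_minus_cancel using cb[of i] Nb by (rule mult_right_mono)
        ultimately show ?thesis using x[rule_format, of i] by simp
      qed
      obtain r l where r: "strict_mono r" "l \<in> span B" "(\<lambda>i. N (y (r i) - l)) \<longlonglongrightarrow> 0"
        by (rule bounded_subseq_convergentE[OF bsc y yb])
      \<comment> \<open>The coefficients are thinned out only along \<open>r\<close>, so that the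
        vectors still converge along the common subsequence \<open>r \<circ> s\<close>.\<close>
      have "bounded (range (c \<circ> r))"
        unfolding bounded_iff using cb by auto
      then obtain a s where s: "strict_mono s" "((c \<circ> r) \<circ> s) \<longlonglongrightarrow> a"
        using bounded_imp_convergent_subsequence by blast
      have lV: "l \<in> ?V" using r sub by blast
      have bnd: "N (x ((r \<circ> s) i) - (a *\<^sub>R b + l))
          \<le> \<bar>c (r (s i)) - a\<bar> * N b + N (y (r (s i)) - l)" for i
      proof -
        have "(c (r (s i)) - a) *\<^sub>R b \<in> ?V" using bV by (rule span_scale)
        moreover have "y (r (s i)) - l \<in> ?V" using yV lV by (rule span_diff)
        ultimately have "N ((c (r (s i)) - a) *\<^sub>R b + (y (r (s i)) - l))
          \<le> N ((c (r (s i)) - a) *\<^sub>R b) + N (y (r (s i)) - l)"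
          by (rule norm_on_triangle[OF insert.prems])
        then show ?thesis unfolding scale xeq by (simp add: algebra_simps)
      qed
      have "(\<lambda>i. \<bar>c (r (s i)) - a\<bar>) \<longlonglongrightarrow> \<bar>a - a\<bar>"
        using s(2) by (intro tendsto_intros) (simp add: o_def)
      moreover have "(\<lambda>i. N (y (r (s i)) - l)) \<longlonglongrightarrow> 0"
        using LIMSEQ_subseq_LIMSEQ[OF r(3) s(1)] by (simp add: o_def)
      ultimately have "(\<lambda>i. \<bar>c (r (s i)) - a\<bar> * N b + N (y (r (s i)) - l)) \<longlonglongrightarrow> \<bar>a - a\<bar> * N b + 0"
        by (intro tendsto_add tendsto_mult_right)
      then have up: "(\<lambda>i. \<bar>c (r (s i)) - a\<bar> * N b + N (y (r (s i)) - l)) \<longlonglongrightarrow> 0" by simp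
      have limV: "a *\<^sub>R b + l \<in> ?V" using bV lV by (intro span_add span_scale)
      have "0 \<le> N (x ((r \<circ> s) i) - (a *\<^sub>R b + l))" for i
        using x limV by (intro norm_on_nonneg[OF insert.prems] span_diff) auto
      then have "(\<lambda>i. N (x ((r \<circ> s) i) - (a *\<^sub>R b + l))) \<longlonglongrightarrow> 0"
        by (intro tendsto_sandwich[OF _ _ tendsto_const up] always_eventually allI bnd)
      then show "\<exists>r l. strict_mono r \<and> l \<in> ?V \<and> (\<lambda>i. N (x (r i) - l)) \<longlonglongrightarrow> 0"
        using strict_mono_o[OF r(1) s(1)] limV by blast
    qed
  qed
qed

section \<open>Domination of seminorms and sequential continuity\<close>

text \<open>The same splitting of \<open>x\<close> into a multiple of \<open>b\<close> and a
  remainder in \<open>span B\<close> is used: the multiple is controlled by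
  \<open>norm_on_coordinate_bound\<close>, the remainder by the induction hypothesis.\<close>

lemma seminorm_on_le_norm_on:
  assumes "finite B" "norm_on (span B) N" "seminorm_on (span B) p"
  obtains C where "\<And>x. x \<in> span B \<Longrightarrow> p x \<le> C * N x"
proof -
  have "\<exists>C\<ge>0. \<forall>x\<in>span B. p x \<le> C * N x"
    using assms
  proof (induction B)
    case empty
    \<comment> \<open>A seminorm vanishes at 0 by homogeneity with factor 0, and
      \<open>span {}\<close> contains nothing else.\<close>
    have "p (0 *\<^sub>R 0) = \<bar>0\<bar> * p 0"
      using empty(2) span_zero by (rule seminorm_on_scale)
    then have "p 0 = 0" "N 0 = 0"
      using empty by (simp_all add: norm_on_def)
    then show ?case by (auto intro: exI[of _ 0])
  next
    case (insert b B)
    let ?V = "span (insert b B)"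
    have sub: "span B \<subseteq> ?V" by (simp add: span_mono subset_insertI)
    have bV: "b \<in> ?V" by (simp add: span_base)
    have NB: "norm_on (span B) N" using insert.prems(1) sub by (rule norm_on_subset)
    have pB: "seminorm_on (span B) p"
      using insert.prems(2) sub unfolding seminorm_on_def by blast
    obtain C where C: "C \<ge> 0" "\<And>x. x \<in> span B \<Longrightarrow> p x \<le> C * N x"
      using insert.IH[OF NB pB] by blast
    show ?case
    proof (cases "b \<in> span B")
      case True
      then show ?thesis using C by (auto simp: span_redundant)
    next
      case False
      obtain e where e: "e > 0" "\<And>c y. y \<in> span B \<Longrightarrow> \<bar>c\<bar> * e \<le> N (c *\<^sub>R b + y)"
        using norm_on_coordinate_bound[OF insert.prems(1) False
            bounded_subseq_convergent_span[OF insert.hyps(1) NB]] by metis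
      have Nb: "0 \<le> N b" "0 \<le> p b"
        using insert.prems bV by (simp_all add: norm_on_def seminorm_on_def)
      \<comment> \<open>This constant collects three estimates: the absolute value of
        \<open>c\<close> is at most \<open>N x / e\<close>, the norm of \<open>y\<close> exceeds
        that of \<open>x\<close> by at most the norm of \<open>c *\<^sub>R b\<close>, and
        \<open>p y\<close> is at most \<open>C * N y\<close>.\<close>
      define A where "A = (p b + C * N b) / e + C"
      have "p x \<le> A * N x" if "x \<in> ?V" for x
      proof -
        obtain c y where y: "y \<in> span B" "x = c *\<^sub>R b + y" using \<open>x \<in> ?V\<close> span_insertE by blast
        have yV: "y \<in> ?V" using y sub by blast
        have cV: "c *\<^sub>R b \<in> ?V" "(- c) *\<^sub>R b \<in> ?V" using bV span_scale by blast+
        have "N ((- c) *\<^sub>R b) = \<bar>- c\<bar> * N b" "p (c *\<^sub>R b) = \<bar>c\<bar> * p b"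
          by (rule norm_on_scale[OF insert.prems(1) bV] seminorm_on_scale[OF insert.prems(2) bV])+
        moreover have "N (x + (- c) *\<^sub>R b) \<le> N x + N ((- c) *\<^sub>R b)"
          using that cV(2) by (rule norm_on_triangle[OF insert.prems(1)])
        moreover have "x + (- c) *\<^sub>R b = y" using y by simp
        ultimately have ny: "N y \<le> N x + \<bar>c\<bar> * N b" and pc: "p (c *\<^sub>R b) = \<bar>c\<bar> * p b" by simp_all
        have "p x \<le> p (c *\<^sub>R b) + p y"
          unfolding y(2) using cV(1) yV by (rule seminorm_on_triangle[OF insert.prems(2)])
        also have "\<dots> \<le> \<bar>c\<bar> * p b + C * (N x + \<bar>c\<bar> * N b)"
          using pc C(2)[OF y(1)] mult_left_mono[OF ny C(1)] by linarith
        also have "\<dots> = \<bar>c\<bar> * (p b + C * N b) + C * N x" by (simp add: algebra_simps)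
        also have "\<dots> \<le> N x / e * (p b + C * N b) + C * N x"
          using e(2)[OF y(1), of c] e(1) Nb C(1) y(2)
          by (intro add_right_mono mult_right_mono) (simp_all add: field_simps)
        also have "\<dots> = A * N x" by (simp add: A_def algebra_simps add_divide_distrib)
        finally show ?thesis .
      qed
      moreover have "A \<ge> 0" using Nb C(1) e(1) by (simp add: A_def)
      ultimately show ?thesis by blast
    qed
  qed
  then show ?thesis using that by blast
qed

text \<open>Domination by a multiple of \<open>N\<close> and the reverse triangle inequality make
  \<open>p\<close> Lipschitz with respect to \<open>N\<close>.\<close>

lemma tendsto_seminorm_on:
  assumes V: "subspace V" "fin_dim V" and N: "norm_on V N" and p: "seminorm_on V p"
    and x: "\<And>i. x i \<in> V" "l \<in> V" and lim: "((\<lambda>i. N (x i - l)) \<longlongrightarrow> 0) F"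
  shows "((\<lambda>i. p (x i)) \<longlongrightarrow> p l) F"
proof -
  obtain B where "finite B" "V = span B" using V(2) by (auto simp: fin_dim_def)
  then obtain C where C: "\<And>x. x \<in> V \<Longrightarrow> p x \<le> C * N x"
    using seminorm_on_le_norm_on N p by metis
  have "((\<lambda>i. C * N (x i - l)) \<longlongrightarrow> 0) F"
    using tendsto_mult_left[OF lim, of C] by simp
  moreover have "\<forall>\<^sub>F i in F. norm (p (x i) - p l) \<le> C * N (x i - l)"
  proof (intro always_eventually allI)
    fix i
    show "norm (p (x i) - p l) \<le> C * N (x i - l)"
      using seminorm_on_diff_le[OF V(1) p x(1) x(2), of i] C[OF subspace_diff[OF V(1) x(1) x(2)], of i]
      by simp
  qed
  ultimately have "((\<lambda>i. p (x i) - p l) \<longlongrightarrow> 0) F"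
    by (rule Lim_null_comparison[rotated])
  then show ?thesis by (simp add: LIM_zero_iff)
qed

text \<open>This serves the tax, which is homogeneous but not assumed subadditive; its limits have
  to come from topological continuity instead of a Lipschitz bound.\<close>

lemma tendsto_continuous_map_norm_topology:
  fixes f :: "'a::real_vector \<Rightarrow> 'b::topological_space"
  assumes V: "subspace V" and N: "norm_on V N"
    and f: "continuous_map (norm_topology V N) (top_of_set S) f"
    and x: "\<And>i. x i \<in> V" "l \<in> V" and lim: "((\<lambda>i. N (x i - l)) \<longlongrightarrow> 0) F"
  shows "((\<lambda>i. f (x i)) \<longlongrightarrow> f l) F"
proof -
  interpret Metric_space V "norm_dist V N" using V N by (rule Metric_space_norm_dist)
  have "limitin mtopology x l F"
    using lim x unfolding limitin_metric_dist_null by (simp add: norm_dist_def)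
  then have "limitin (top_of_set S) (f \<circ> x) (f l) F"
    using f[unfolded norm_topology_def] by (rule continuous_map_limit[rotated])
  then have "limitin euclidean (f \<circ> x) (f l) F"
    by (simp only: limitin_subtopology)
  then show ?thesis by (simp add: o_def)
qed

section \<open>Finite dimension of subspaces and products\<close>

text \<open>A maximal independent subset of \<open>K\<close> spans \<open>K\<close>, and it is
  finite because it is independent inside the span of a finite set.\<close>

lemma fin_dim_subspace:
  assumes "fin_dim V" "subspace K" "K \<subseteq> V"
  shows "fin_dim K"
proof -
  obtain B where B: "finite B" "V = span B" using assms(1) by (auto simp: fin_dim_def)
  obtain A where A: "A \<subseteq> K" "independent A" "K \<subseteq> span A"
    using maximal_independent_subset by blast
  have "finite A" using independent_span_bound[OF B(1) A(2)] A(1) assms(3) B(2) by blast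
  moreover have "K = span A" using A span_minimal[OF A(1) assms(2)] by blast
  ultimately show ?thesis unfolding fin_dim_def by blast
qed

lemma subspace_fin_dim: "fin_dim V \<Longrightarrow> subspace V"
  by (auto simp: fin_dim_def)

lemma bounded_subseq_convergent_fin_dim:
  assumes "fin_dim V" "norm_on V N"
  shows "bounded_subseq_convergent V N"
proof -
  obtain B where "finite B" "V = span B" using assms(1) by (auto simp: fin_dim_def)
  then show ?thesis using assms(2) by (simp add: bounded_subseq_convergent_span)
qed

lemma prod_space_subspace:
  assumes "\<And>k. k \<in> \<Lambda> \<Longrightarrow> subspace (D k)"
  shows "subspace (prod_space \<Lambda> D)"
proof -
  have "0 \<in> D k" "x \<in> D k \<Longrightarrow> y \<in> D k \<Longrightarrow> x + y \<in> D k" "x \<in> D k \<Longrightarrow> c *\<^sub>R x \<in> D k"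
    if "k \<in> \<Lambda>" for k x y c
    using assms[OF that] by (simp_all add: subspace_def)
  then show ?thesis
    unfolding subspace_def prod_space_def by (simp add: scaleR_fun_def)
qed

text \<open>A family is the finite sum of its coordinates placed in their slots, so the embedded
  spanning sets of the factors span a space containing the product. The inclusion suffices, because
  a subspace of a finite-dimensional space is finite-dimensional.\<close>

lemma fin_dim_prod_space:
  assumes "finite \<Lambda>" "\<And>k. k \<in> \<Lambda> \<Longrightarrow> fin_dim (D k)"
  shows "fin_dim (prod_space \<Lambda> D)"
proof -
  have "\<exists>B. finite B \<and> D k = span B" if "k \<in> \<Lambda>" for k
    using assms(2)[OF that] by (simp add: fin_dim_def)
  then obtain B where B: "\<And>k. k \<in> \<Lambda> \<Longrightarrow> finite (B k)" "\<And>k. k \<in> \<Lambda> \<Longrightarrow> D k = span (B k)"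
    by metis
  define emb :: "int \<Rightarrow> 'a \<Rightarrow> int \<Rightarrow> 'a" where "emb = (\<lambda>k v j. if j = k then v else 0)"
  have lin: "linear (emb k)" for k
    by (rule linearI) (auto simp: emb_def fun_eq_iff scaleR_fun_def)
  define E where "E = (\<Union>k\<in>\<Lambda>. emb k ` B k)"
  have "prod_space \<Lambda> D \<subseteq> span E"
  proof
    fix d assume d: "d \<in> prod_space \<Lambda> D"
    have "(\<Sum>k\<in>\<Lambda>. emb k (d k)) j = (\<Sum>k\<in>\<Lambda>. emb k (d k) j)" for j
      using assms(1) by (induction rule: finite_induct) simp_all
    then have "d = (\<Sum>k\<in>\<Lambda>. emb k (d k))"
      using d assms(1) by (auto simp: fun_eq_iff emb_def prod_space_def)
    moreover have "emb k (d k) \<in> span E" if k: "k \<in> \<Lambda>" for k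
    proof -
      have "d k \<in> span (B k)" using d k B(2) by (auto simp: prod_space_def)
      then have "emb k (d k) \<in> span (emb k ` B k)"
        by (simp add: linear_span_image[OF lin])
      also have "\<dots> \<subseteq> span E" using k by (intro span_mono) (auto simp: E_def)
      finally show ?thesis .
    qed
    ultimately show "d \<in> span E" by (metis span_sum)
  qed
  moreover have "finite E" using assms(1) B(1) by (simp add: E_def)
  moreover have "subspace (prod_space \<Lambda> D)"
    using assms(2) by (intro prod_space_subspace subspace_fin_dim)
  ultimately show ?thesis using fin_dim_subspace[of "span E"] by (auto simp: fin_dim_def)
qed

section \<open>Distance to the gauge space and the quotient sphere\<close>

lemma dist_to_le:
  assumes "subspace K" "norm_on K N" "\<Gamma> \<subseteq> K" "d \<in> K" "\<gamma> \<in> \<Gamma>"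
  shows "dist_to N d \<Gamma> \<le> N (d - \<gamma>)"
  unfolding dist_to_def
proof (rule cINF_lower[OF _ assms(5)])
  show "bdd_below ((\<lambda>\<gamma>. N (d - \<gamma>)) ` \<Gamma>)"
    using assms(1,3,4) by (intro bdd_belowI2[of _ 0] norm_on_nonneg[OF assms(2)] subspace_diff) auto
qed

lemma dist_to_scale:
  assumes "subspace K" "norm_on K N" "subspace \<Gamma>" "\<Gamma> \<subseteq> K" "d \<in> K" "c > 0"
  shows "dist_to N (c *\<^sub>R d) \<Gamma> = c * dist_to N d \<Gamma>"
proof -
  have le: "c * dist_to N d \<Gamma> \<le> dist_to N (c *\<^sub>R d) \<Gamma>" if d: "d \<in> K" and c: "c > 0" for c d
    unfolding dist_to_def[of N "c *\<^sub>R d"]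
  proof (rule cINF_greatest)
    show "\<Gamma> \<noteq> {}" using assms(3) subspace_0 by blast
    fix \<gamma> assume g: "\<gamma> \<in> \<Gamma>"
    have g': "(1 / c) *\<^sub>R \<gamma> \<in> \<Gamma>" using assms(3) g by (rule subspace_scale)
    have "N (c *\<^sub>R (d - (1 / c) *\<^sub>R \<gamma>)) = \<bar>c\<bar> * N (d - (1 / c) *\<^sub>R \<gamma>)"
      using assms(1,4) g' d by (intro norm_on_scale[OF assms(2)] subspace_diff) auto
    moreover have "c *\<^sub>R (d - (1 / c) *\<^sub>R \<gamma>) = c *\<^sub>R d - \<gamma>"
      using c by (simp add: scaleR_diff_right)
    ultimately show "c * dist_to N d \<Gamma> \<le> N (c *\<^sub>R d - \<gamma>)"
      using dist_to_le[OF assms(1,2,4) d g'] c by simp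
  qed
  \<comment> \<open>The reverse inequality is \<open>le\<close> again, applied to the vector
    \<open>c *\<^sub>R d\<close> and the factor \<open>1 / c\<close>.\<close>
  have "(1 / c) * dist_to N (c *\<^sub>R d) \<Gamma> \<le> dist_to N ((1 / c) *\<^sub>R c *\<^sub>R d) \<Gamma>"
    using assms by (intro le subspace_scale) auto
  then have "dist_to N (c *\<^sub>R d) \<Gamma> \<le> c * dist_to N d \<Gamma>"
    using assms(6) by (simp add: field_simps)
  then show ?thesis using le[OF assms(5,6)] by simp
qed

text \<open>A finite-dimensional subspace is closed, so a vector outside it has a positive gap to
  it. This makes the quotient norm definite.\<close>

lemma dist_to_pos:
  assumes "fin_dim K" "norm_on K N" "subspace \<Gamma>" "\<Gamma> \<subseteq> K" "d \<in> K" "d \<notin> \<Gamma>"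
  shows "dist_to N d \<Gamma> > 0"
proof -
  have "bounded_subseq_convergent \<Gamma> N"
    using assms fin_dim_subspace norm_on_subset bounded_subseq_convergent_fin_dim by blast
  then obtain e where "e > 0" "\<And>w. w \<in> \<Gamma> \<Longrightarrow> e \<le> N (d - w)"
    using norm_on_gap[OF subspace_fin_dim[OF assms(1)] assms(2,4) _ assms(5,6)] by blast
  moreover from this have "e \<le> dist_to N d \<Gamma>"
    unfolding dist_to_def using subspace_0[OF assms(3)] by (intro cINF_greatest) auto
  ultimately show ?thesis by linarith
qed

lemma quot_sphereE:
  assumes "subspace K" "subspace \<Gamma>" "\<Gamma> \<subseteq> K" "q \<in> quot_sphere N K \<Gamma>"
  obtains d where "d \<in> K" "q = quot_class K \<Gamma> d" "dist_to N d \<Gamma> = 1"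
proof -
  obtain d where d: "d \<in> K" "q = quot_class K \<Gamma> d"
    using assms(4) by (auto simp: quot_sphere_def quot_space_def quot_class_def elim: quotientE)
  moreover have "dist_to N d \<Gamma> = 1"
    using assms d quot_norm_quot_class[OF assms(1-3) d(1), of N] by (simp add: quot_sphere_def)
  ultimately show ?thesis using that by blast
qed

lemma quot_class_in_quot_sphere:
  assumes "subspace K" "subspace \<Gamma>" "\<Gamma> \<subseteq> K" "d \<in> K" "dist_to N d \<Gamma> = 1"
  shows "quot_class K \<Gamma> d \<in> quot_sphere N K \<Gamma>"
proof -
  have "quot_class K \<Gamma> d \<in> quot_space K \<Gamma>"
    unfolding quot_class_def quot_space_def using assms(4) by (rule quotientI)
  then show ?thesis
    using quot_norm_quot_class[OF assms(1-4), of N] assms(5) by (simp add: quot_sphere_def)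
qed

text \<open>This shows that the quotient collapses to a single class when \<open>\<Gamma>\<close> is
  all of \<open>K\<close>, which nontriviality excludes.\<close>

lemma quot_class_of_mem:
  assumes "subspace K" "subspace \<Gamma>" "\<Gamma> \<subseteq> K" "d \<in> \<Gamma>"
  shows "quot_class K \<Gamma> d = quot_class K \<Gamma> 0"
proof -
  have "(0, d) \<in> quot_rel K \<Gamma>"
    using assms subspace_0[OF assms(1)] by (auto simp: quot_rel_def)
  then show ?thesis
    using equiv_class_eq[OF equiv_quot_rel[OF assms(1-3)]] by (auto simp: quot_class_def)
qed

section \<open>Coercivity of a homogeneous gauge-invariant functional\<close>

text \<open>The functional \<open>M\<close> is not assumed subadditive, because the tax need not be.
  Sequential continuity replaces it in the compactness argument, and homogeneity carries the bound
  from the unit sphere to all of \<open>K\<close>.\<close>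

lemma comp_margin_coercive:
  assumes K: "fin_dim K" and N: "norm_on K N" and \<Gamma>: "subspace \<Gamma>" "\<Gamma> \<subset> K"
    and M_nonneg: "\<And>d. d \<in> K \<Longrightarrow> 0 \<le> M d"
    and M_scale: "\<And>c d. d \<in> K \<Longrightarrow> M (c *\<^sub>R d) = \<bar>c\<bar> * M d"
    and M_gauge: "\<And>d \<gamma>. d \<in> K \<Longrightarrow> \<gamma> \<in> \<Gamma> \<Longrightarrow> M (d + \<gamma>) = M d"
    and M_kernel: "\<And>d. d \<in> K \<Longrightarrow> M d = 0 \<Longrightarrow> d \<in> \<Gamma>"
    and M_cont: "\<And>x l. (\<And>i::nat. x i \<in> K) \<Longrightarrow> l \<in> K \<Longrightarrow> (\<lambda>i. N (x i - l)) \<longlonglongrightarrow> 0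
      \<Longrightarrow> (\<lambda>i. M (x i)) \<longlonglongrightarrow> M l"
  shows comp_margin_pos: "comp_margin N K \<Gamma> M > 0"
    and comp_margin_le: "\<And>d. d \<in> K \<Longrightarrow> comp_margin N K \<Gamma> M * dist_to N d \<Gamma> \<le> M d"
proof -
  have Ks: "subspace K" using K by (rule subspace_fin_dim)
  have sub: "\<Gamma> \<subseteq> K" using \<Gamma>(2) by blast
  note q = Ks \<Gamma>(1) sub
  have descend: "descend M (quot_class K \<Gamma> d) = M d" if "d \<in> K" for d
    using descend_quot_class[OF q that] M_gauge that by blast
  \<comment> \<open>Dividing by the distance, which is positive outside \<open>\<Gamma>\<close>,
    gives a representative of a point of the unit sphere.\<close>
  have normalize: "\<exists>u\<in>K. dist_to N u \<Gamma> = 1 \<and> M d = dist_to N d \<Gamma> * M u"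
    if "d \<in> K" "d \<notin> \<Gamma>" for d
  proof -
    let ?t = "dist_to N d \<Gamma>"
    have t: "?t > 0" using dist_to_pos[OF K N \<Gamma>(1) sub that] .
    have "dist_to N ((1 / ?t) *\<^sub>R d) \<Gamma> = 1"
      using dist_to_scale[OF Ks N \<Gamma>(1) sub that(1), of "1 / ?t"] t by simp
    moreover have "M d = ?t * M ((1 / ?t) *\<^sub>R d)"
      using M_scale[OF that(1), of "1 / ?t"] t by simp
    ultimately show ?thesis using subspace_scale[OF Ks that(1)] by blast
  qed
  have "\<exists>m>0. \<forall>d\<in>K. dist_to N d \<Gamma> = 1 \<longrightarrow> m \<le> M d"
  proof (rule ccontr)
    assume "\<not> ?thesis"
    then have "\<exists>d\<in>K. dist_to N d \<Gamma> = 1 \<and> M d < inverse (real (Suc i))" for i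
      by (meson inverse_positive_iff_positive not_le of_nat_0_less_iff zero_less_Suc)
    then obtain d where d: "\<And>i. d i \<in> K" "\<And>i. dist_to N (d i) \<Gamma> = 1"
      "\<And>i. M (d i) < inverse (real (Suc i))"
      by metis
    \<comment> \<open>The infimum of these norms is 1, so some value lies below any larger number; 2
      is an arbitrary choice.\<close>
    have "\<exists>\<gamma>\<in>\<Gamma>. N (d i - \<gamma>) \<le> 2" for i
    proof (rule ccontr)
      assume "\<not> ?thesis"
      then have "2 \<le> dist_to N (d i) \<Gamma>"
        unfolding dist_to_def using subspace_0[OF \<Gamma>(1)] by (intro cINF_greatest) auto
      then show False using d(2)[of i] by simp
    qed
    then obtain g where g: "\<And>i. g i \<in> \<Gamma>" "\<And>i. N (d i - g i) \<le> 2" by metis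
    \<comment> \<open>Subtracting \<open>g i\<close> changes only the representative:
      \<open>M\<close> keeps its value by gauge invariance, while the norms become bounded.\<close>
    define x where "x = (\<lambda>i. d i - g i)"
    have xK: "x i \<in> K" for i
      unfolding x_def using d(1) g(1) sub by (intro subspace_diff[OF Ks]) auto
    have Mx: "M (x i) < inverse (real (Suc i))" for i
      using M_gauge[OF d(1) subspace_neg[OF \<Gamma>(1) g(1)], of i i] d(3)[of i] by (simp add: x_def)
    have "N (x i) \<le> 2" for i using g(2) by (simp add: x_def)
    then obtain r l where r: "strict_mono r" "l \<in> K" and lim: "(\<lambda>i. N (x (r i) - l)) \<longlonglongrightarrow> 0"
      by (rule bounded_subseq_convergentE[OF bounded_subseq_convergent_fin_dim[OF K N] xK])
    have "(\<lambda>i. M (x (r i))) \<longlonglongrightarrow> M l" using M_cont[OF xK r(2) lim] .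
    moreover have "(\<lambda>i. inverse (real (Suc (r i)))) \<longlonglongrightarrow> 0"
      using LIMSEQ_subseq_LIMSEQ[OF LIMSEQ_inverse_real_of_nat r(1)] by (simp add: o_def)
    ultimately have "M l \<le> 0"
      using Mx by (intro LIMSEQ_le) (auto intro: less_imp_le)
    then have "l \<in> \<Gamma>" using M_kernel M_nonneg r(2) by (simp add: order_antisym)
    \<comment> \<open>Since \<open>l\<close> lies in \<open>\<Gamma>\<close>, so does
      \<open>g (r i) + l\<close>, and \<open>x (r i) - l\<close> is \<open>d (r i)\<close> minus
      this element. Its norm is thus at least the distance 1, although it tends to 0.\<close>
    have "1 \<le> N (x (r i) - l)" for i
    proof -
      have "g (r i) + l \<in> \<Gamma>" using \<Gamma>(1) g(1) \<open>l \<in> \<Gamma>\<close> by (rule subspace_add)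
      then have "dist_to N (d (r i)) \<Gamma> \<le> N (d (r i) - (g (r i) + l))"
        by (rule dist_to_le[OF Ks N sub d(1)])
      then show ?thesis using d(2) by (simp add: x_def algebra_simps)
    qed
    then have "1 \<le> (0::real)" using LIMSEQ_le_const[OF lim] by blast
    then show False by simp
  qed
  then obtain m where m: "m > 0" "\<And>d. d \<in> K \<Longrightarrow> dist_to N d \<Gamma> = 1 \<Longrightarrow> m \<le> M d" by blast
  have lower: "m \<le> descend M s" if "s \<in> quot_sphere N K \<Gamma>" for s
    using quot_sphereE[OF q that] m(2) descend by metis
  \<comment> \<open>The greatest-lower-bound argument for the margin needs a nonempty sphere; a
    vector outside \<open>\<Gamma>\<close>, normalized, provides a point of it.\<close>
  obtain v where "v \<in> K" "v \<notin> \<Gamma>" using \<Gamma>(2) by blast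
  then have "quot_sphere N K \<Gamma> \<noteq> {}"
    using normalize quot_class_in_quot_sphere[OF q] by blast
  then have "m \<le> comp_margin N K \<Gamma> M"
    unfolding comp_margin_def using lower by (intro cINF_greatest)
  then show "comp_margin N K \<Gamma> M > 0" using m(1) by linarith
  fix d assume d: "d \<in> K"
  show "comp_margin N K \<Gamma> M * dist_to N d \<Gamma> \<le> M d"
  proof (cases "d \<in> \<Gamma>")
    case True
    have "N 0 = 0" using N subspace_0[OF Ks] unfolding norm_on_def by blast
    then have "dist_to N d \<Gamma> \<le> 0"
      using dist_to_le[OF Ks N sub d True] by simp
    then show ?thesis
      using \<open>comp_margin N K \<Gamma> M > 0\<close> M_nonneg[OF d] by (smt (verit) mult_nonneg_nonpos)
  next
    case False
    then obtain u where u: "u \<in> K" "dist_to N u \<Gamma> = 1" "M d = dist_to N d \<Gamma> * M u"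
      using normalize d by blast
    have "comp_margin N K \<Gamma> M \<le> descend M (quot_class K \<Gamma> u)"
      unfolding comp_margin_def
      using lower quot_class_in_quot_sphere[OF q u(1,2)] by (intro cINF_lower bdd_belowI2)
    then show ?thesis
      using u descend dist_to_pos[OF K N \<Gamma>(1) sub d False] by (simp add: mult.commute)
  qed
qed

section \<open>Application to the composite measurement\<close>

theorem theorem5p4:
  fixes k\<^sub>0 :: int and L :: nat and \<Lambda> :: "int set"
    and D :: "int \<Rightarrow> 'a::real_vector set"
    and n :: "int \<Rightarrow> 'a \<Rightarrow> real"
    and N :: "(int \<Rightarrow> 'a) \<Rightarrow> real"
    and K \<Gamma> :: "(int \<Rightarrow> 'a) set"
    and G :: "'c::real_normed_vector \<Rightarrow> int \<Rightarrow> 'a"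
    and OP :: "(int \<Rightarrow> 'a) \<Rightarrow> 'p::real_normed_vector"
    and OF :: "(int \<Rightarrow> 'a) \<Rightarrow> 'f::real_normed_vector"
    and OE :: "(int \<Rightarrow> 'a) \<Rightarrow> 'e::real_normed_vector"
    and OT :: "(int \<Rightarrow> 'a) \<Rightarrow> 't::real_normed_vector"
    and Ob :: "(int \<Rightarrow> 'a) \<Rightarrow> 'p \<times> 'f \<times> 'e \<times> 't"
    and NY :: "'p \<times> 'f \<times> 'e \<times> 't \<Rightarrow> real"
    and R :: "int \<Rightarrow> 'a \<Rightarrow> 'a"
    and Tax :: "(int \<Rightarrow> 'a) \<Rightarrow> real"
    and C\<^sub>R C\<^sub>T :: real
  assumes Lambda: "\<Lambda> = {k\<^sub>0..k\<^sub>0 + int L}"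
    and D_fin_dim: "\<And>k. k \<in> \<Lambda> \<Longrightarrow> fin_dim (D k)"
    and D_norm: "\<And>k. k \<in> \<Lambda> \<Longrightarrow> norm_on (D k) (n k)"
    and prod_norm: "norm_on (prod_space \<Lambda> D) N"
    and K_subspace: "subspace K" "K \<subseteq> prod_space \<Lambda> D"
    and C_fin_dim: "fin_dim (UNIV :: 'c set)"
    and G_linear: "linear G" "range G \<subseteq> prod_space \<Lambda> D"
    and Gamma: "\<Gamma> = K \<inter> range G"
    and Y_fin_dim: "fin_dim (UNIV :: 'p set)" "fin_dim (UNIV :: 'f set)"
      "fin_dim (UNIV :: 'e set)" "fin_dim (UNIV :: 't set)"
    and Y_norm: "norm_on UNIV NY"
    and Ob: "Ob = (\<lambda>d. (OP d, OF d, OE d, OT d))"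
    and Ob_linear: "linear_map_on K UNIV Ob"
    and R_linear: "\<And>k. k \<in> adj \<Lambda> \<Longrightarrow> linear_map_on (D k) (D (k + 1)) (R k)"
    and Tax_cont: "continuous_map (norm_topology K N) (top_of_set {0..}) Tax"
    and Tax_homogeneous: "\<And>c d. d \<in> K \<Longrightarrow> Tax (c *\<^sub>R d) = \<bar>c\<bar> * Tax d"
    and C_pos: "C\<^sub>R > 0" "C\<^sub>T > 0"
    and Q_nontrivial: "quot_space K \<Gamma> \<noteq> {quot_class K \<Gamma> 0}"
    and gauge: "\<And>d \<gamma>. d \<in> K \<Longrightarrow> \<gamma> \<in> \<Gamma> \<Longrightarrow>
      Ob (d + \<gamma>) = Ob d \<and> Rep \<Lambda> n R (d + \<gamma>) = Rep \<Lambda> n R d \<and> Tax (d + \<gamma>) = Tax d"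
    and kernel_free: "\<And>d. d \<in> K \<Longrightarrow> Ob d = 0 \<Longrightarrow> Rep \<Lambda> n R d = 0 \<Longrightarrow> Tax d = 0 \<Longrightarrow> d \<in> \<Gamma>"
  shows "comp_margin N K \<Gamma> (comp_measure NY Ob (Rep \<Lambda> n R) Tax C\<^sub>R C\<^sub>T) > 0 \<and>
    (\<forall>d\<in>K. NY (Ob d) + C\<^sub>R * Rep \<Lambda> n R d + C\<^sub>T * Tax d
      \<ge> comp_margin N K \<Gamma> (comp_measure NY Ob (Rep \<Lambda> n R) Tax C\<^sub>R C\<^sub>T) * dist_to N d \<Gamma>)"
proof -
  let ?M = "comp_measure NY Ob (Rep \<Lambda> n R) Tax C\<^sub>R C\<^sub>T"
  let ?t = "\<lambda>k d. n (k + 1) (d (k + 1) - R k (d k))"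
  have N: "norm_on K N" using prod_norm K_subspace(2) by (rule norm_on_subset)
  have "fin_dim (prod_space \<Lambda> D)"
    using D_fin_dim by (intro fin_dim_prod_space) (simp_all add: Lambda)
  then have K: "fin_dim K" using K_subspace by (rule fin_dim_subspace)
  have \<Gamma>s: "subspace \<Gamma>"
    unfolding Gamma using K_subspace(1) linear_subspace_image[OF G_linear(1) subspace_UNIV]
    by (rule subspace_inter)
  have "\<Gamma> \<noteq> K"
  proof
    assume eq: "\<Gamma> = K"
    have "quot_space K \<Gamma> = quot_class K \<Gamma> ` K"
      by (auto simp: quot_space_def quotient_def quot_class_def)
    also have "\<dots> = {quot_class K \<Gamma> 0}"
      using quot_class_of_mem[OF K_subspace(1) \<Gamma>s] subspace_0[OF K_subspace(1)] eq by blast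
    finally show False using Q_nontrivial by simp
  qed
  then have \<Gamma>K: "\<Gamma> \<subset> K" by (auto simp: Gamma)
  have Osemi: "seminorm_on K (\<lambda>d. NY (Ob d))"
    using norm_on_imp_seminorm_on[OF Y_norm] Ob_linear by (rule seminorm_on_compose)
  \<comment> \<open>Each discrepancy is a norm of a linear image of \<open>d\<close>. Treating the
    summands of \<open>Rep\<close> one at a time gives its homogeneity and continuity without
    proving a triangle inequality for the root of the sum of squares.\<close>
  have tsemi: "seminorm_on K (?t k)" if k: "k \<in> adj \<Lambda>" for k
  proof (rule seminorm_on_compose[where f = "\<lambda>d. d (k + 1) - R k (d k)"])
    have k': "k \<in> \<Lambda>" "k + 1 \<in> \<Lambda>" using k by (auto simp: adj_def)
    show "seminorm_on (D (k + 1)) (n (k + 1))"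
      using D_norm[OF k'(2)] by (rule norm_on_imp_seminorm_on)
    have dD: "d j \<in> D j" if "d \<in> K" "j \<in> \<Lambda>" for d j
      using that K_subspace(2) by (auto simp: prod_space_def)
    have R: "R k x \<in> D (k + 1)" "y \<in> D k \<Longrightarrow> R k (x + y) = R k x + R k y"
      "R k (c *\<^sub>R x) = c *\<^sub>R R k x" if "x \<in> D k" for x y c
      using R_linear[OF k] that by (auto simp: linear_map_on_def)
    show "linear_map_on K (D (k + 1)) (\<lambda>d. d (k + 1) - R k (d k))"
      unfolding linear_map_on_def
      using subspace_fin_dim[OF D_fin_dim[OF k'(2)]] dD k' R
      by (auto simp: scaleR_fun_def scaleR_diff_right intro: subspace_diff)
  qed
  \<comment> \<open>Nonnegativity is encoded in the codomain \<open>{0..}\<close> of the continuous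
    map, and the points of its domain are those of \<open>K\<close>.\<close>
  have tax_nonneg: "0 \<le> Tax d" if "d \<in> K" for d
  proof -
    have "d \<in> topspace (norm_topology K N)"
      using that Metric_space.topspace_mtopology[OF Metric_space_norm_dist[OF K_subspace(1) N]]
      by (simp add: norm_topology_def)
    then show ?thesis using Tax_cont by (auto simp: continuous_map_def)
  qed
  have rep_nonneg: "0 \<le> Rep \<Lambda> n R d" for d
    by (simp add: Rep_def sum_nonneg)
  have rep_scale: "Rep \<Lambda> n R (c *\<^sub>R d) = \<bar>c\<bar> * Rep \<Lambda> n R d" if "d \<in> K" for c d
  proof -
    have "?t k (c *\<^sub>R d) = \<bar>c\<bar> * ?t k d" if "k \<in> adj \<Lambda>" for k
      using tsemi[OF that] \<open>d \<in> K\<close> by (rule seminorm_on_scale)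
    then have "Rep \<Lambda> n R (c *\<^sub>R d) = sqrt (c\<^sup>2 * (\<Sum>k\<in>adj \<Lambda>. (?t k d)\<^sup>2))"
      by (simp add: Rep_def power_mult_distrib sum_distrib_left)
    then show ?thesis by (simp add: Rep_def real_sqrt_mult)
  qed
  have O_nonneg: "0 \<le> NY (Ob d)" for d
    using Y_norm UNIV_I by (rule norm_on_nonneg)
  \<comment> \<open>A vanishing sum of nonnegative terms has vanishing terms; positivity of the two
    weights then removes them, and definiteness of \<open>NY\<close> gives
    \<open>Ob d = 0\<close>.\<close>
  have kernel: "d \<in> \<Gamma>" if "d \<in> K" "?M d = 0" for d
  proof -
    have "0 \<le> C\<^sub>R * Rep \<Lambda> n R d" "0 \<le> C\<^sub>T * Tax d"
      using C_pos rep_nonneg tax_nonneg[OF that(1)] by simp_all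
    then have "NY (Ob d) = 0" "C\<^sub>R * Rep \<Lambda> n R d = 0" "C\<^sub>T * Tax d = 0"
      using that(2) O_nonneg[of d] unfolding comp_measure_def by linarith+
    moreover from this(1) have "Ob d = 0" using Y_norm unfolding norm_on_def by blast
    ultimately show ?thesis using kernel_free that(1) C_pos by simp
  qed
  have cont: "(\<lambda>i. ?M (x i)) \<longlonglongrightarrow> ?M l"
    if x: "\<And>i. x i \<in> K" "l \<in> K" and lim: "(\<lambda>i. N (x i - l)) \<longlonglongrightarrow> 0" for x l
  proof -
    note semi = tendsto_seminorm_on[OF K_subspace(1) K N]
    have "(\<lambda>i. NY (Ob (x i))) \<longlonglongrightarrow> NY (Ob l)"
      by (rule semi[OF Osemi x lim])
    moreover have "(\<lambda>i. ?t k (x i)) \<longlonglongrightarrow> ?t k l" if "k \<in> adj \<Lambda>" for k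
      by (rule semi[OF tsemi[OF that] x lim])
    then have "(\<lambda>i. Rep \<Lambda> n R (x i)) \<longlonglongrightarrow> Rep \<Lambda> n R l"
      unfolding Rep_def by (intro tendsto_real_sqrt tendsto_sum tendsto_power)
    moreover have "(\<lambda>i. Tax (x i)) \<longlonglongrightarrow> Tax l"
      by (rule tendsto_continuous_map_norm_topology[OF K_subspace(1) N Tax_cont, OF x lim])
    ultimately show ?thesis
      unfolding comp_measure_def by (intro tendsto_add tendsto_mult_left)
  qed
  have nonneg: "0 \<le> ?M d" if "d \<in> K" for d
    using O_nonneg[of d] rep_nonneg tax_nonneg[OF that] C_pos by (simp add: comp_measure_def)
  have scale: "?M (c *\<^sub>R d) = \<bar>c\<bar> * ?M d" if "d \<in> K" for c d
    using that Osemi rep_scale[OF that] Tax_homogeneous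
    by (simp add: comp_measure_def seminorm_on_def algebra_simps)
  have inv: "?M (d + \<gamma>) = ?M d" if "d \<in> K" "\<gamma> \<in> \<Gamma>" for d \<gamma>
    using gauge[OF that] by (simp add: comp_measure_def)
  have "comp_margin N K \<Gamma> ?M > 0"
    by (rule comp_margin_pos[OF K N \<Gamma>s \<Gamma>K]) (fact nonneg scale inv kernel cont)+
  moreover have "comp_margin N K \<Gamma> ?M * dist_to N d \<Gamma> \<le> ?M d" if "d \<in> K" for d
    by (rule comp_margin_le[where M = "?M", OF K N \<Gamma>s \<Gamma>K])
      (fact nonneg scale inv kernel cont that)+
  ultimately show ?thesis by (simp only: comp_measure_def[symmetric]) blast
qed

end
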